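(* Let $S$ and $R$ be rings and let $f:S\rightarrow R$ be a (not necessarily unitary) ring homomorphism with $f[S]\subseteq Z(R)$. Then $f$ satisfies SGB if and only if for every nonempty chain $\mathcal D\subseteq\mathrm{Spec}(S)$, for every nonempty maximal $\mathcal D$-chain $\mathcal C\subseteq\mathrm{Spec}(R)$, and for every cut $\mathcal A=(\mathcal A^L,\mathcal A^R)$ of $\mathcal C$ such that $\mathcal A\neq(\emptyset,\mathcal C)$ and $\mathcal A\neq(\mathcal C,\emptyset)$ (thus $|\mathcal C|\geq 2$), the following holds: for every $P\in\mathcal D$ there exists $Q_1\in\mathcal A^L$ such that $P\subseteq f^{-1}[Q_1]$ or there exists $Q_2\in\mathcal A^R$ such that $f^{-1}[Q_2]\subseteq P$.
   Context: Rings are nontrivial, associative, with identity, not necessarily commutative; homomorphisms need not send $1$ to $1$. $Z(R)$ is the center of $R$. $\mathrm{Spec}$ denotes the set of prime (two-sided, proper) ideals: $P$ is prime if $aRb\subseteq P$ implies $a\in P$ or $b\in P$. $\subset$ means proper inclusion. All chains are with respect to containment. An ideal $Q$ of $R$ lies over an ideal $P$ of $S$ if $f^{-1}[Q]=P$. (For $Q\in\mathrm{Spec}(R)$, $f^{-1}[Q]$ is either a prime ideal of $S$ or equal to $S$.) SGB: for any $P_1\subset P_2\subset P_3$ in $\mathrm{Spec}(S)$ and every $Q_1\subset Q_3$ in $\mathrm{Spec}(R)$ with $Q_1$ lying over $P_1$ and $Q_3$ lying over $P_3$, there is $Q_2\in\mathrm{Spec}(R)$ with $Q_1\subset Q_2\subset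 Q_3$ lying over $P_2$. For a chain $\mathcal D\subseteq\mathrm{Spec}(S)$, a $\mathcal D$-chain is a chain $\mathcal C\subseteq\mathrm{Spec}(R)$ with $f^{-1}[Q]\in\mathcal D$ for every $Q\in\mathcal C$. A maximal $\mathcal D$-chain is a $\mathcal D$-chain that is maximal, with respect to containment, among $\mathcal D$-chains. A cut $\mathcal A=(\mathcal A^L,\mathcal A^R)$ of a totally ordered set $T$ is a partition of $T$ into two (possibly empty) subsets $\mathcal A^L$, $\mathcal A^R$ such that $\alpha<\beta$ for every $\alpha\in\mathcal A^L$ and $\beta\in\mathcal A^R$. Here $\mathcal C$ is totally ordered by containment. *)

theory Defs
  imports "HOL-Algebra.Ideal"
begin

text \<open>
  Unlike \<^const>\<open>ring_hom\<close>, a homomorphism here need not send one to one.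
\<close>

definition rng_hom :: "[('a, 'm) ring_scheme, ('b, 'n) ring_scheme] \<Rightarrow> ('a \<Rightarrow> 'b) set" where
  "rng_hom S R =
    {h. h \<in> carrier S \<rightarrow> carrier R \<and>
      (\<forall>x\<in>carrier S. \<forall>y\<in>carrier S.
        h (x \<otimes>\<^bsub>S\<^esub> y) = h x \<otimes>\<^bsub>R\<^esub> h y \<and> h (x \<oplus>\<^bsub>S\<^esub> y) = h x \<oplus>\<^bsub>R\<^esub> h y)}"

definition ring_center :: "('a, 'm) ring_scheme \<Rightarrow> 'a set" where
  "ring_center R = {z \<in> carrier R. \<forall>x\<in>carrier R. z \<otimes>\<^bsub>R\<^esub> x = x \<otimes>\<^bsub>R\<^esub> z}"

text \<open>
  The library's \<^locale>\<open>primeideal\<close> is restricted to commutative rings. In a ring that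
  need not be commutative, primeness of the two-sided ideal \<open>P\<close> is the condition that
  \<open>a R b \<subseteq> P\<close> implies \<open>a \<in> P\<close> or \<open>b \<in> P\<close>.
\<close>

definition prime_ideal :: "('a, 'm) ring_scheme \<Rightarrow> 'a set \<Rightarrow> bool" where
  "prime_ideal R P \<longleftrightarrow> ideal P R \<and> P \<noteq> carrier R \<and>
    (\<forall>a\<in>carrier R. \<forall>b\<in>carrier R.
      {a \<otimes>\<^bsub>R\<^esub> r \<otimes>\<^bsub>R\<^esub> b | r. r \<in> carrier R} \<subseteq> P \<longrightarrow> a \<in> P \<or> b \<in> P)"

definition Spec :: "('a, 'm) ring_scheme \<Rightarrow> 'a set set" where
  "Spec R = {P. prime_ideal R P}"

text \<open>
  The preimage is cut down to the carrier of \<open>S\<close>, since \<open>f\<close> is a total function on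
  the underlying type and is only meaningful on the carrier.
\<close>

definition contraction :: "('a, 'm) ring_scheme \<Rightarrow> ('a \<Rightarrow> 'b) \<Rightarrow> 'b set \<Rightarrow> 'a set" where
  "contraction S f Q = {s \<in> carrier S. f s \<in> Q}"

definition lies_over :: "('a, 'm) ring_scheme \<Rightarrow> ('a \<Rightarrow> 'b) \<Rightarrow> 'b set \<Rightarrow> 'a set \<Rightarrow> bool" where
  "lies_over S f Q P \<longleftrightarrow> contraction S f Q = P"

definition SGB ::
  "('a, 'm) ring_scheme \<Rightarrow> ('b, 'n) ring_scheme \<Rightarrow> ('a \<Rightarrow> 'b) \<Rightarrow> bool" where
  "SGB S R f \<longleftrightarrow>
    (\<forall>P\<^sub>1\<in>Spec S. \<forall>P\<^sub>2\<in>Spec S. \<forall>P\<^sub>3\<in>Spec S. P\<^sub>1 \<subset> P\<^sub>2 \<and> P\<^sub>2 \<subset> P\<^sub>3 \<longrightarrow>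
      (\<forall>Q\<^sub>1\<in>Spec R. \<forall>Q\<^sub>3\<in>Spec R.
        Q\<^sub>1 \<subset> Q\<^sub>3 \<and> lies_over S f Q\<^sub>1 P\<^sub>1 \<and> lies_over S f Q\<^sub>3 P\<^sub>3 \<longrightarrow>
        (\<exists>Q\<^sub>2\<in>Spec R. Q\<^sub>1 \<subset> Q\<^sub>2 \<and> Q\<^sub>2 \<subset> Q\<^sub>3 \<and> lies_over S f Q\<^sub>2 P\<^sub>2)))"

definition D_chain ::
  "('a, 'm) ring_scheme \<Rightarrow> ('b, 'n) ring_scheme \<Rightarrow> ('a \<Rightarrow> 'b) \<Rightarrow> 'a set set \<Rightarrow> 'b set set \<Rightarrow> bool"
  where
  "D_chain S R f \<D> \<C> \<longleftrightarrow> subset.chain (Spec R) \<C> \<and> (\<forall>Q\<in>\<C>. contraction S f Q \<in> \<D>)"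

definition maximal_D_chain ::
  "('a, 'm) ring_scheme \<Rightarrow> ('b, 'n) ring_scheme \<Rightarrow> ('a \<Rightarrow> 'b) \<Rightarrow> 'a set set \<Rightarrow> 'b set set \<Rightarrow> bool"
  where
  "maximal_D_chain S R f \<D> \<C> \<longleftrightarrow>
    D_chain S R f \<D> \<C> \<and> (\<nexists>\<C>'. D_chain S R f \<D> \<C>' \<and> \<C> \<subset> \<C>')"

text \<open>
  The order on \<open>T\<close> is that of the type; for families of sets it is containment. Either
  part of a cut may be empty.
\<close>

definition is_cut :: "'c::order set \<Rightarrow> 'c set \<times> 'c set \<Rightarrow> bool" where
  "is_cut T A \<longleftrightarrow> fst A \<union> snd A = T \<and> fst A \<inter> snd A = {} \<and>
    (\<forall>\<alpha>\<in>fst A. \<forall>\<beta>\<in>snd A. \<alpha> < \<beta>)"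

end

theory Submission
  imports Defs "HOL-Algebra.Ring_Divisibility"
begin

text \<open>
  For the forward direction, suppose that \<open>P \<in> \<D>\<close> lies strictly between the
  contractions of the two sides of a cut \<open>(L, U)\<close>. The intersection \<open>Q\<^sub>3\<close> of \<open>U\<close> is prime, but
  the union of \<open>L\<close> need not be, as \<open>R\<close> is not commutative. The products \<open>f s \<cdot> x\<close> with
  \<open>s \<notin> P\<close> and \<open>x \<notin> Q\<^sub>3\<close> form an m-system, because \<open>f\<close> has central values, and it misses \<open>\<Union>L\<close>.
  A prime \<open>Q\<^sub>1 \<supseteq> \<Union>L\<close> avoiding it is contained in \<open>Q\<^sub>3\<close> and contracts into \<open>P\<close>. Now \<open>Q\<^sub>1\<close>, \<open>Q\<^sub>3\<close>
  or, by SGB, a prime between them lies over \<open>P\<close> and could be added to the chain.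

  Conversely, apply the cut condition to a maximal chain through \<open>Q\<^sub>1\<close> and \<open>Q\<^sub>3\<close> over
  \<open>{P\<^sub>1, P\<^sub>2, P\<^sub>3}\<close>: if it had no member over \<open>P\<^sub>2\<close>, it would be cut into the members over \<open>P\<^sub>1\<close> and
  those over \<open>P\<^sub>3\<close>.
\<close>

section \<open>Prime ideals and m-systems\<close>

text \<open>The noncommutative substitute for a multiplicatively closed set: the complement of a
  prime ideal is the model case. Nonemptiness forces every ideal that avoids \<open>M\<close> to be
  proper.\<close>

definition m_system :: "('a, 'm) ring_scheme \<Rightarrow> 'a set \<Rightarrow> bool" where
  "m_system R M \<longleftrightarrow> M \<subseteq> carrier R \<and> M \<noteq> {} \<and>
    (\<forall>a\<in>M. \<forall>b\<in>M. \<exists>r\<in>carrier R. a \<otimes>\<^bsub>R\<^esub> r \<otimes>\<^bsub>R\<^esub> b \<in> M)"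

lemma prime_idealD:
  assumes "prime_ideal R P"
  shows "ideal P R" "P \<noteq> carrier R"
  using assms by (auto simp: prime_ideal_def)

lemma prime_ideal_witness:
  assumes "prime_ideal R P" "a \<in> carrier R" "b \<in> carrier R" "a \<notin> P" "b \<notin> P"
  obtains r where "r \<in> carrier R" "a \<otimes>\<^bsub>R\<^esub> r \<otimes>\<^bsub>R\<^esub> b \<notin> P"
  using assms unfolding prime_ideal_def by blast

lemma prime_ideal_subset_carrier:
  assumes "prime_ideal R P"
  shows "P \<subseteq> carrier R"
  using prime_idealD(1)[OF assms]
  by (simp add: additive_subgroup.a_subset ideal.axioms(1))

lemma prime_ideal_one_notin:
  assumes "prime_ideal R P"
  shows "\<one>\<^bsub>R\<^esub> \<notin> P"
  using prime_idealD[OF assms] ideal.one_imp_carrier by blast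

text \<open>A central \<open>z\<close> slides past the middle factor, z r x = r (z x), so one
  product in \<open>P\<close> already puts all of z R x into \<open>P\<close>. Central factors can
  therefore be split off as in a commutative ring.\<close>

lemma prime_ideal_central_mult:
  assumes P: "prime_ideal R P" and z: "z \<in> ring_center R" and x: "x \<in> carrier R"
    and zx: "z \<otimes>\<^bsub>R\<^esub> x \<in> P"
  shows "z \<in> P \<or> x \<in> P"
proof (rule ccontr)
  assume "\<not> (z \<in> P \<or> x \<in> P)"
  moreover have zc: "z \<in> carrier R" using z by (simp add: ring_center_def)
  ultimately obtain r where r: "r \<in> carrier R" "z \<otimes>\<^bsub>R\<^esub> r \<otimes>\<^bsub>R\<^esub> x \<notin> P"
    using prime_ideal_witness[OF P zc x] by blast
  interpret ideal P R by (rule prime_idealD(1)[OF P])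
  have "z \<otimes>\<^bsub>R\<^esub> r \<otimes>\<^bsub>R\<^esub> x = r \<otimes>\<^bsub>R\<^esub> (z \<otimes>\<^bsub>R\<^esub> x)"
    using z zc x r(1) by (simp add: ring_center_def m_assoc)
  then show False using r I_l_closed[OF zx r(1)] by simp
qed

context ring
begin

text \<open>Closure under negation comes for free, since the negative of \<open>x\<close> is the
  multiple of \<open>x\<close> by minus one.\<close>

lemma idealI_closed:
  assumes "I \<subseteq> carrier R" "\<zero> \<in> I"
    and add: "\<And>x y. x \<in> I \<Longrightarrow> y \<in> I \<Longrightarrow> x \<oplus> y \<in> I"
    and l: "\<And>x r. x \<in> I \<Longrightarrow> r \<in> carrier R \<Longrightarrow> r \<otimes> x \<in> I"
    and r: "\<And>x r. x \<in> I \<Longrightarrow> r \<in> carrier R \<Longrightarrow> x \<otimes> r \<in> I"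
  shows "ideal I R"
proof (rule idealI[OF ring_axioms])
  show "subgroup I (add_monoid R)"
  proof (rule group.subgroupI[OF a_group])
    fix x assume "x \<in> I"
    then have "(\<ominus> \<one>) \<otimes> x \<in> I" "x \<in> carrier R" using l assms(1) by auto
    then show "inv\<^bsub>add_monoid R\<^esub> x \<in> I" by (simp add: l_minus a_inv_def[symmetric])
  qed (use assms in auto)
qed (use l r in auto)

text \<open>Left multiples stay inside because \<open>Q\<close> absorbs them. Right multiples stay
  inside because the extra factor merges with the middle factor \<open>r\<close>; quantifying over
  \<open>r\<close> is what makes the set two-sided.\<close>

lemma ideal_left_colon:
  assumes "ideal Q R" "b \<in> carrier R"
  shows "ideal {x \<in> carrier R. \<forall>r\<in>carrier R. x \<otimes> r \<otimes> b \<in> Q} R"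
proof -
  interpret Q: ideal Q R by fact
  show ?thesis
  proof (rule idealI_closed, goal_cases)
    case (4 x t)
    then have "t \<otimes> (x \<otimes> r \<otimes> b) \<in> Q" if "r \<in> carrier R" for r using that Q.I_l_closed by blast
    then show ?case using 4 assms(2) by (auto simp: m_assoc)
  next
    case (5 x t)
    then have "x \<otimes> (t \<otimes> r) \<otimes> b \<in> Q" if "r \<in> carrier R" for r using that by blast
    then show ?case using 5 assms(2) by (auto simp: m_assoc)
  qed (use assms(2) in \<open>auto simp: l_distr\<close>)
qed

lemma ideal_right_colon:
  assumes "ideal Q R" "a \<in> carrier R"
  shows "ideal {x \<in> carrier R. \<forall>r\<in>carrier R. a \<otimes> r \<otimes> x \<in> Q} R"
proof -
  interpret Q: ideal Q R by fact
  show ?thesis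
  proof (rule idealI_closed, goal_cases)
    case (5 x t)
    then have "a \<otimes> r \<otimes> x \<otimes> t \<in> Q" if "r \<in> carrier R" for r using that Q.I_r_closed by blast
    then show ?case using 5 assms(2) by (auto simp: m_assoc)
  next
    case (4 x t)
    then have "a \<otimes> (r \<otimes> t) \<otimes> x \<in> Q" if "r \<in> carrier R" for r using that by blast
    then show ?case using 4 assms(2) by (auto simp: m_assoc)
  qed (use assms(2) in \<open>auto simp: r_distr\<close>)
qed

lemma ideal_Union_chain:
  assumes "subset.chain (Spec R) L" "L \<noteq> {}"
  shows "ideal (\<Union>L) R"
proof -
  have "subset.chain {I. ideal I R} L"
    using assms(1) prime_idealD(1) by (auto simp: subset.chain_def Spec_def)
  from chain_Union_is_ideal[OF this] show ?thesis using assms(2) by simp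
qed

text \<open>
  Colon ideals of the form \<open>{x. x R b \<subseteq> Q}\<close> replace the products of generated ideals in the
  usual argument that an ideal maximal with respect to avoiding an m-system is prime.
\<close>

lemma ex_prime_ideal_avoiding:
  assumes I: "ideal I R" and M: "m_system R M" and IM: "I \<inter> M = {}"
  obtains Q where "prime_ideal R Q" "I \<subseteq> Q" "Q \<inter> M = {}"
proof -
  define \<A> where "\<A> = {J. ideal J R \<and> I \<subseteq> J \<and> J \<inter> M = {}}"
  have "\<exists>Q\<in>\<A>. \<forall>X\<in>\<A>. Q \<subseteq> X \<longrightarrow> X = Q"
  proof (rule subset_Zorn_nonempty)
    show "\<A> \<noteq> {}" using I IM by (auto simp: \<A>_def)
    fix \<C> assume ne: "\<C> \<noteq> {}" and ch: "subset.chain \<A> \<C>"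
    then have "subset.chain {J. ideal J R} \<C>" by (auto simp: subset.chain_def \<A>_def)
    from chain_Union_is_ideal[OF this] have "ideal (\<Union>\<C>) R" using ne by simp
    moreover have "\<C> \<subseteq> \<A>" using ch by (simp add: subset.chain_def)
    ultimately show "\<Union>\<C> \<in> \<A>" using ne by (fastforce simp: \<A>_def)
  qed
  then obtain Q where QA: "Q \<in> \<A>" and max: "\<And>X. X \<in> \<A> \<Longrightarrow> Q \<subseteq> X \<Longrightarrow> X = Q" by blast
  then have Q: "ideal Q R" "I \<subseteq> Q" "Q \<inter> M = {}" by (auto simp: \<A>_def)
  interpret Q: ideal Q R by (rule Q(1))
  \<comment> \<open>Maximality of \<open>Q\<close> in the form used below: every strictly larger
    ideal contains an element of \<open>M\<close>.\<close>
  have meets: "\<exists>m\<in>M. m \<in> J" if "ideal J R" "Q \<subseteq> J" "c \<in> J" "c \<notin> Q" for J c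
    using max[of J] that Q(2) by (auto simp: \<A>_def)
  have "prime_ideal R Q"
    unfolding prime_ideal_def
  proof (intro conjI ballI impI)
    show "Q \<noteq> carrier R" using Q(3) M by (auto simp: m_system_def)
    fix a b assume a: "a \<in> carrier R" and b: "b \<in> carrier R"
      and ab: "{a \<otimes> r \<otimes> b |r. r \<in> carrier R} \<subseteq> Q"
    show "a \<in> Q \<or> b \<in> Q"
    proof (rule ccontr)
      assume n: "\<not> (a \<in> Q \<or> b \<in> Q)"
      \<comment> \<open>The elements \<open>a\<close> and \<open>b\<close> are replaced by members
        of \<open>M\<close> one after the other. The left colon ideal of \<open>b\<close> contains
        \<open>Q\<close> and \<open>a\<close>, hence some \<open>m\<close> in \<open>M\<close>; the
        right colon ideal of \<open>m\<close> contains \<open>Q\<close> and \<open>b\<close>, hence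
        some \<open>m'\<close> in \<open>M\<close>. Then m R m' lies in \<open>Q\<close>, although
        it must meet \<open>M\<close>.\<close>
      have "\<exists>m\<in>M. m \<in> {x \<in> carrier R. \<forall>r\<in>carrier R. x \<otimes> r \<otimes> b \<in> Q}"
        by (rule meets[of _ a])
          (use a b ab n ideal_left_colon[OF Q(1) b] in \<open>auto simp: Q.I_r_closed\<close>)
      then obtain m where m: "m \<in> M" "m \<in> carrier R" "\<forall>r\<in>carrier R. m \<otimes> r \<otimes> b \<in> Q" by blast
      have "\<exists>m'\<in>M. m' \<in> {x \<in> carrier R. \<forall>r\<in>carrier R. m \<otimes> r \<otimes> x \<in> Q}"
        by (rule meets[of _ b])
          (use b n m ideal_right_colon[OF Q(1) m(2)] in \<open>auto simp: Q.I_l_closed\<close>)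
      then obtain m' where m': "m' \<in> M" "\<forall>r\<in>carrier R. m \<otimes> r \<otimes> m' \<in> Q" by blast
      then show False using m(1) M Q(3) unfolding m_system_def by blast
    qed
  qed (rule Q(1))
  then show thesis using that Q by blast
qed

text \<open>If \<open>a\<close> is missing from one member and \<open>b\<close> from another, the
  smaller of the two members misses both, and its primeness applies.\<close>

lemma prime_ideal_Inter_chain:
  assumes U: "subset.chain (Spec R) U" and ne: "U \<noteq> {}"
  shows "prime_ideal R (\<Inter>U)"
proof -
  have pr: "\<And>Q. Q \<in> U \<Longrightarrow> prime_ideal R Q" using U by (auto simp: subset.chain_def Spec_def)
  show ?thesis
    unfolding prime_ideal_def
  proof (intro conjI ballI impI)
    show "ideal (\<Inter>U) R" using pr prime_idealD(1) ne by (intro i_Intersect) auto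
    show "\<Inter>U \<noteq> carrier R" using prime_ideal_one_notin pr ne by blast
    fix a b assume ab: "a \<in> carrier R" "b \<in> carrier R"
      and sub: "{a \<otimes> r \<otimes> b |r. r \<in> carrier R} \<subseteq> \<Inter>U"
    show "a \<in> \<Inter>U \<or> b \<in> \<Inter>U"
    proof (rule ccontr)
      assume "\<not> (a \<in> \<Inter>U \<or> b \<in> \<Inter>U)"
      then obtain Q Q' where Q: "Q \<in> U" "a \<notin> Q" "Q' \<in> U" "b \<notin> Q'" by blast
      then have "Q \<subseteq> Q' \<or> Q' \<subseteq> Q" using U by (auto simp: subset.chain_def)
      then obtain Q'' where "Q'' \<in> U" "a \<notin> Q''" "b \<notin> Q''" using Q by blast
      then show False using prime_ideal_witness[OF pr ab] sub by blast
    qed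
  qed
qed

end

section \<open>Homomorphisms with central image\<close>

locale central_rng_hom = S: ring S + R: ring R
  for S :: "('a, 'm) ring_scheme" (structure) and R :: "('b, 'n) ring_scheme" (structure) +
  fixes f :: "'a \<Rightarrow> 'b"
  assumes hom: "f \<in> rng_hom S R" and central: "f ` carrier S \<subseteq> ring_center R"
begin

lemma hom_closed: "x \<in> carrier S \<Longrightarrow> f x \<in> carrier R"
  using hom by (auto simp: rng_hom_def)

lemma hom_mult: "x \<in> carrier S \<Longrightarrow> y \<in> carrier S \<Longrightarrow> f (x \<otimes>\<^bsub>S\<^esub> y) = f x \<otimes>\<^bsub>R\<^esub> f y"
  using hom by (auto simp: rng_hom_def)

lemma hom_add: "x \<in> carrier S \<Longrightarrow> y \<in> carrier S \<Longrightarrow> f (x \<oplus>\<^bsub>S\<^esub> y) = f x \<oplus>\<^bsub>R\<^esub> f y"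
  using hom by (auto simp: rng_hom_def)

lemma hom_zero: "f \<zero>\<^bsub>S\<^esub> = \<zero>\<^bsub>R\<^esub>"
proof -
  have "f \<zero>\<^bsub>S\<^esub> \<oplus>\<^bsub>R\<^esub> f \<zero>\<^bsub>S\<^esub> = f \<zero>\<^bsub>S\<^esub>" using hom_add[of "\<zero>\<^bsub>S\<^esub>" "\<zero>\<^bsub>S\<^esub>"] by simp
  then show ?thesis using R.add.r_cancel_one hom_closed by (metis S.zero_closed)
qed

lemma hom_commute: "s \<in> carrier S \<Longrightarrow> x \<in> carrier R \<Longrightarrow> f s \<otimes>\<^bsub>R\<^esub> x = x \<otimes>\<^bsub>R\<^esub> f s"
  using central by (auto simp: ring_center_def)

lemma ideal_contraction:
  assumes "ideal Q R"
  shows "ideal (contraction S f Q) S"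
proof -
  interpret Q: ideal Q R by fact
  show ?thesis
    by (rule S.idealI_closed)
      (auto simp: contraction_def hom_zero hom_add hom_mult hom_closed Q.I_l_closed Q.I_r_closed)
qed

text \<open>Taking one as the middle factor puts f a * f b into \<open>Q\<close>, and centrality of
  \<open>f a\<close> splits this product. Properness is a hypothesis because \<open>f\<close> need
  not send one to one, so a prime of \<open>R\<close> may contract to all of
  \<open>S\<close>.\<close>

lemma prime_ideal_contraction:
  assumes Q: "prime_ideal R Q" and proper: "contraction S f Q \<noteq> carrier S"
  shows "prime_ideal S (contraction S f Q)"
  unfolding prime_ideal_def
proof (intro conjI ballI impI)
  show "ideal (contraction S f Q) S" using ideal_contraction prime_idealD(1)[OF Q] .
  fix a b assume a: "a \<in> carrier S" and b: "b \<in> carrier S"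
    and sub: "{a \<otimes>\<^bsub>S\<^esub> r \<otimes>\<^bsub>S\<^esub> b |r. r \<in> carrier S} \<subseteq> contraction S f Q"
  have "a \<otimes>\<^bsub>S\<^esub> \<one>\<^bsub>S\<^esub> \<otimes>\<^bsub>S\<^esub> b \<in> contraction S f Q" using sub by blast
  then have "f a \<otimes>\<^bsub>R\<^esub> f b \<in> Q" using a b by (simp add: contraction_def hom_mult)
  then show "a \<in> contraction S f Q \<or> b \<in> contraction S f Q"
    using prime_ideal_central_mult[OF Q, of "f a" "f b"] central a b hom_closed
    by (auto simp: contraction_def)
qed (rule proper)

text \<open>For f s * x and f t * y, primeness of \<open>P\<close> and \<open>Q\<close> gives
  \<open>u\<close> and \<open>r\<close> with s u t outside \<open>P\<close> and x r y outside
  \<open>Q\<close>. The middle factor f u * r then works, since the central values of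
  \<open>f\<close> can be collected on the left.\<close>

lemma m_system_mult:
  assumes P: "prime_ideal S P" and Q: "prime_ideal R Q"
  shows "m_system R {f s \<otimes>\<^bsub>R\<^esub> x | s x. s \<in> carrier S - P \<and> x \<in> carrier R - Q}" (is "m_system R ?M")
  unfolding m_system_def
proof (intro conjI ballI)
  show "?M \<subseteq> carrier R" using hom_closed by auto
  show "?M \<noteq> {}" using prime_ideal_one_notin[OF P] prime_ideal_one_notin[OF Q] by blast
  fix a b assume "a \<in> ?M" "b \<in> ?M"
  then obtain s x t y where
    a: "a = f s \<otimes>\<^bsub>R\<^esub> x" "s \<in> carrier S" "s \<notin> P" "x \<in> carrier R" "x \<notin> Q" and
    b: "b = f t \<otimes>\<^bsub>R\<^esub> y" "t \<in> carrier S" "t \<notin> P" "y \<in> carrier R" "y \<notin> Q" by blast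
  obtain u where u: "u \<in> carrier S" "s \<otimes>\<^bsub>S\<^esub> u \<otimes>\<^bsub>S\<^esub> t \<notin> P"
    using prime_ideal_witness[OF P] a b by metis
  obtain r where r: "r \<in> carrier R" "x \<otimes>\<^bsub>R\<^esub> r \<otimes>\<^bsub>R\<^esub> y \<notin> Q"
    using prime_ideal_witness[OF Q] a b by metis
  note c = a(2,4) b(2,4) u(1) r(1) hom_closed
  \<comment> \<open>The factors are commuted one at a time: \<open>f u\<close> past
    \<open>x\<close>, \<open>f t\<close> past \<open>r\<close>, and finally \<open>f t\<close> past
    \<open>x\<close>.\<close>
  have "a \<otimes>\<^bsub>R\<^esub> (f u \<otimes>\<^bsub>R\<^esub> r) \<otimes>\<^bsub>R\<^esub> b = f s \<otimes>\<^bsub>R\<^esub> (x \<otimes>\<^bsub>R\<^esub> f u) \<otimes>\<^bsub>R\<^esub> (r \<otimes>\<^bsub>R\<^esub> f t) \<otimes>\<^bsub>R\<^esub> y"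
    using c by (simp add: a(1) b(1) R.m_assoc)
  also have "\<dots> = f s \<otimes>\<^bsub>R\<^esub> (f u \<otimes>\<^bsub>R\<^esub> x) \<otimes>\<^bsub>R\<^esub> (f t \<otimes>\<^bsub>R\<^esub> r) \<otimes>\<^bsub>R\<^esub> y"
    using c hom_commute[of u x] hom_commute[of t r] by simp
  also have "\<dots> = f s \<otimes>\<^bsub>R\<^esub> f u \<otimes>\<^bsub>R\<^esub> (x \<otimes>\<^bsub>R\<^esub> f t) \<otimes>\<^bsub>R\<^esub> r \<otimes>\<^bsub>R\<^esub> y"
    using c by (simp add: R.m_assoc)
  also have "\<dots> = f s \<otimes>\<^bsub>R\<^esub> f u \<otimes>\<^bsub>R\<^esub> (f t \<otimes>\<^bsub>R\<^esub> x) \<otimes>\<^bsub>R\<^esub> r \<otimes>\<^bsub>R\<^esub> y"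
    using c hom_commute[of t x] by simp
  also have "\<dots> = f (s \<otimes>\<^bsub>S\<^esub> u \<otimes>\<^bsub>S\<^esub> t) \<otimes>\<^bsub>R\<^esub> (x \<otimes>\<^bsub>R\<^esub> r \<otimes>\<^bsub>R\<^esub> y)"
    using c by (simp add: hom_mult R.m_assoc)
  finally have "a \<otimes>\<^bsub>R\<^esub> (f u \<otimes>\<^bsub>R\<^esub> r) \<otimes>\<^bsub>R\<^esub> b = \<dots>" .
  then have "a \<otimes>\<^bsub>R\<^esub> (f u \<otimes>\<^bsub>R\<^esub> r) \<otimes>\<^bsub>R\<^esub> b \<in> ?M" using u r c by blast
  then show "\<exists>r\<in>carrier R. a \<otimes>\<^bsub>R\<^esub> r \<otimes>\<^bsub>R\<^esub> b \<in> ?M" using c by blast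
qed

text \<open>Each \<open>J\<close> in \<open>L\<close> misses the m-system: f s * x in
  \<open>J\<close> would put \<open>f s\<close> or \<open>x\<close> into \<open>J\<close>, hence
  \<open>s\<close> into \<open>P\<close> or \<open>x\<close> into \<open>Q\<close>. A prime above
  the union of \<open>L\<close> that avoids the m-system satisfies both upper bounds: s = 1 gives
  the one by \<open>Q\<close>, and x = 1 the one by \<open>P\<close>.\<close>

lemma ex_prime_ideal_contracting_into:
  assumes L: "subset.chain (Spec R) L" "L \<noteq> {}"
    and P: "prime_ideal S P" and Q: "prime_ideal R Q"
    and below: "\<And>J. J \<in> L \<Longrightarrow> J \<subseteq> Q \<and> contraction S f J \<subseteq> P"
  obtains Q' where "prime_ideal R Q'" "\<Union>L \<subseteq> Q'" "Q' \<subseteq> Q" "contraction S f Q' \<subseteq> P"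
proof -
  let ?M = "{f s \<otimes>\<^bsub>R\<^esub> x | s x. s \<in> carrier S - P \<and> x \<in> carrier R - Q}"
  have "f s \<otimes>\<^bsub>R\<^esub> x \<notin> J"
    if J: "J \<in> L" and sx: "s \<in> carrier S" "s \<notin> P" "x \<in> carrier R" "x \<notin> Q" for J s x
  proof
    assume mem: "f s \<otimes>\<^bsub>R\<^esub> x \<in> J"
    have "prime_ideal R J" using J L by (auto simp: subset.chain_def Spec_def)
    moreover have "f s \<in> ring_center R" using central sx(1) by blast
    ultimately have "f s \<in> J \<or> x \<in> J" using prime_ideal_central_mult mem sx(3) by metis
    then show False using below[OF J] sx by (auto simp: contraction_def)
  qed
  then have "\<Union>L \<inter> ?M = {}" by blast
  then obtain Q' where Q': "prime_ideal R Q'" "\<Union>L \<subseteq> Q'" "Q' \<inter> ?M = {}"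
    using R.ex_prime_ideal_avoiding[OF R.ideal_Union_chain[OF L] m_system_mult[OF P Q]] by blast
  interpret Q': ideal Q' R by (rule prime_idealD(1)[OF Q'(1)])
  have "x \<in> Q" if "x \<in> Q'" for x
  proof (rule ccontr)
    assume "x \<notin> Q"
    \<comment> \<open>This product may differ from \<open>x\<close>, but it still lies in
      \<open>Q'\<close>, because \<open>Q'\<close> absorbs multiples of \<open>x\<close>.\<close>
    then have "f \<one>\<^bsub>S\<^esub> \<otimes>\<^bsub>R\<^esub> x \<in> ?M" using that prime_ideal_one_notin[OF P] Q'.a_subset by blast
    then show False using Q'(3) Q'.I_l_closed[OF that] hom_closed by blast
  qed
  moreover have "s \<in> P" if "s \<in> carrier S" "f s \<in> Q'" for s
  proof (rule ccontr)
    assume "s \<notin> P"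
    then have "f s \<otimes>\<^bsub>R\<^esub> \<one>\<^bsub>R\<^esub> \<in> ?M" using that prime_ideal_one_notin[OF Q] by blast
    then show False using Q'(3) that hom_closed by auto
  qed
  ultimately show thesis by (intro that[OF Q'(1,2)]) (auto simp: contraction_def)
qed

end

section \<open>Maximal chains and their cuts\<close>

lemma contraction_mono: "Q \<subseteq> Q' \<Longrightarrow> contraction S f Q \<subseteq> contraction S f Q'"
  by (auto simp: contraction_def)

lemma maximal_D_chain_absorbs:
  assumes max: "maximal_D_chain S R f \<D> \<C>" and Q: "prime_ideal R Q" "contraction S f Q \<in> \<D>"
    and comp: "\<And>J. J \<in> \<C> \<Longrightarrow> J \<subseteq> Q \<or> Q \<subseteq> J"
  shows "Q \<in> \<C>"
proof (rule ccontr)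
  assume "Q \<notin> \<C>"
  moreover have "D_chain S R f \<D> (insert Q \<C>)"
    using assms by (auto simp: maximal_D_chain_def D_chain_def subset.chain_def Spec_def)
  ultimately show False using max unfolding maximal_D_chain_def by blast
qed

text \<open>Zorn's lemma applies because any two members of a union of nested
  \<open>\<D>\<close>-chains already lie in a common one, where they are comparable.\<close>

lemma D_chain_extends_to_maximal:
  assumes "D_chain S R f \<D> \<C>"
  obtains \<C>' where "maximal_D_chain S R f \<D> \<C>'" "\<C> \<subseteq> \<C>'"
proof -
  define \<A> where "\<A> = {\<C>'. D_chain S R f \<D> \<C>' \<and> \<C> \<subseteq> \<C>'}"
  have "\<exists>M\<in>\<A>. \<forall>X\<in>\<A>. M \<subseteq> X \<longrightarrow> X = M"
  proof (rule subset_Zorn_nonempty)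
    show "\<A> \<noteq> {}" using assms by (auto simp: \<A>_def)
    fix \<K> assume ne: "\<K> \<noteq> {}" and ch: "subset.chain \<A> \<K>"
    have K: "\<And>\<X>. \<X> \<in> \<K> \<Longrightarrow> D_chain S R f \<D> \<X> \<and> \<C> \<subseteq> \<X>"
      using ch by (auto simp: subset.chain_def \<A>_def)
    have "subset.chain (Spec R) (\<Union>\<K>)"
      unfolding subset_chain_def
    proof (intro conjI ballI)
      show "\<Union>\<K> \<subseteq> Spec R" using K by (fastforce simp: D_chain_def subset_chain_def)
      fix X Y assume "X \<in> \<Union>\<K>" "Y \<in> \<Union>\<K>"
      then obtain \<X> \<Y> where XY: "\<X> \<in> \<K>" "X \<in> \<X>" "\<Y> \<in> \<K>" "Y \<in> \<Y>" by blast
      then have "\<X> \<subseteq> \<Y> \<or> \<Y> \<subseteq> \<X>" using ch by (auto simp: subset_chain_def)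
      then obtain \<Z> where "\<Z> \<in> \<K>" "X \<in> \<Z>" "Y \<in> \<Z>" using XY by blast
      then show "X \<subseteq> Y \<or> Y \<subseteq> X" using K[of \<Z>] by (auto simp: D_chain_def subset_chain_def)
    qed
    moreover have "\<forall>Q\<in>\<Union>\<K>. contraction S f Q \<in> \<D>" using K by (auto simp: D_chain_def)
    moreover have "\<C> \<subseteq> \<Union>\<K>" using K ne by blast
    ultimately show "\<Union>\<K> \<in> \<A>" by (simp add: \<A>_def D_chain_def)
  qed
  then obtain M where M: "M \<in> \<A>" "\<And>X. X \<in> \<A> \<Longrightarrow> M \<subseteq> X \<Longrightarrow> X = M" by blast
  then have "maximal_D_chain S R f \<D> M"
    unfolding maximal_D_chain_def \<A>_def by blast
  then show thesis using that M(1) by (auto simp: \<A>_def)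
qed

section \<open>The two implications between SGB and the cut condition\<close>

lemma (in central_rng_hom) SGB_imp_cut:
  assumes sgb: "SGB S R f" and D: "subset.chain (Spec S) \<D>"
    and max: "maximal_D_chain S R f \<D> \<C>"
    and cut: "is_cut \<C> (L, U)" and ne: "L \<noteq> {}" "U \<noteq> {}" and P: "P \<in> \<D>"
  shows "(\<exists>Q\<in>L. P \<subseteq> contraction S f Q) \<or> (\<exists>Q\<in>U. contraction S f Q \<subseteq> P)"
proof (rule ccontr)
  assume neg: "\<not> ?thesis"
  have C: "subset.chain (Spec R) \<C>" "\<And>Q. Q \<in> \<C> \<Longrightarrow> contraction S f Q \<in> \<D>"
    using max by (auto simp: maximal_D_chain_def D_chain_def)
  have LU: "\<C> = L \<union> U" "\<And>X Y. X \<in> L \<Longrightarrow> Y \<in> U \<Longrightarrow> X \<subset> Y"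
    using cut by (auto simp: is_cut_def)
  have comp: "X \<subseteq> Y \<or> Y \<subseteq> X" if "X \<in> \<D>" "Y \<in> \<D>" for X Y
    using D that by (auto simp: subset_chain_def)
  \<comment> \<open>As \<D> is a chain, each failed inclusion turns into the strict reverse
    inclusion.\<close>
  have below: "contraction S f Q \<subset> P" if "Q \<in> L" for Q
    using neg that comp[OF P C(2)[of Q]] LU(1) by blast
  have above: "P \<subset> contraction S f Q" if "Q \<in> U" for Q
    using neg that comp[OF P C(2)[of Q]] LU(1) by blast
  \<comment> \<open>A prime over \<open>P\<close> between the two sides is comparable with all of
    \<C>, so maximality makes it a member. But members of \<C> contract strictly below or strictly
    above \<open>P\<close>.\<close>
  have no_fit: False
    if "prime_ideal R Q" "contraction S f Q = P" "\<Union>L \<subseteq> Q" "Q \<subseteq> \<Inter>U" for Q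
  proof -
    have "Q \<in> \<C>"
    proof (rule maximal_D_chain_absorbs[OF max that(1)])
      show "contraction S f Q \<in> \<D>" using that(2) P by simp
      show "J \<subseteq> Q \<or> Q \<subseteq> J" if "J \<in> \<C>" for J
        using that \<open>\<Union>L \<subseteq> Q\<close> \<open>Q \<subseteq> \<Inter>U\<close> LU(1) by blast
    qed
    then show False using below[of Q] above[of Q] that(2) LU(1) by auto
  qed
  have PS: "prime_ideal S P" using D P by (auto simp: subset_chain_def Spec_def)
  have chains: "subset.chain (Spec R) L" "subset.chain (Spec R) U"
    using C(1) LU(1) by (auto simp: subset_chain_def)
  define Q\<^sub>3 where "Q\<^sub>3 = \<Inter>U"
  have Q3: "prime_ideal R Q\<^sub>3"
    unfolding Q\<^sub>3_def by (rule R.prime_ideal_Inter_chain[OF chains(2) ne(2)])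
  obtain Q\<^sub>1 where Q1: "prime_ideal R Q\<^sub>1" "\<Union>L \<subseteq> Q\<^sub>1" "Q\<^sub>1 \<subseteq> Q\<^sub>3" "contraction S f Q\<^sub>1 \<subseteq> P"
  proof (rule ex_prime_ideal_contracting_into[OF chains(1) ne(1) PS Q3])
    show "J \<subseteq> Q\<^sub>3 \<and> contraction S f J \<subseteq> P" if "J \<in> L" for J
      using below[OF that] LU(2)[OF that] unfolding Q\<^sub>3_def by blast
  qed
  have "contraction S f Q\<^sub>3 = (\<Inter>J\<in>U. contraction S f J)"
    unfolding Q\<^sub>3_def contraction_def using ne(2) by auto
  then have "P \<subseteq> contraction S f Q\<^sub>3" using above by auto
  moreover have "contraction S f Q\<^sub>3 \<noteq> P" using no_fit[OF Q3] Q1(2,3) by (auto simp: Q\<^sub>3_def)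
  moreover have "contraction S f Q\<^sub>1 \<noteq> P" using no_fit[OF Q1(1)] Q1(2,3) by (auto simp: Q\<^sub>3_def)
  ultimately have strict: "contraction S f Q\<^sub>1 \<subset> P" "P \<subset> contraction S f Q\<^sub>3"
    using Q1(4) by auto
  \<comment> \<open>SGB needs contractions that are prime, hence proper. A member \<open>J\<close>
    of \<open>U\<close> contracts into \<D>, so its contraction omits one; the contractions of
    \<open>Q\<^sub>3\<close> and \<open>Q\<^sub>1\<close> are contained in it.\<close>
  obtain J where J: "J \<in> U" using ne(2) by blast
  then have "contraction S f J \<in> Spec S"
    using C(2)[of J] LU(1) D by (auto simp: subset_chain_def)
  then have "\<one>\<^bsub>S\<^esub> \<notin> contraction S f J" using prime_ideal_one_notin by (auto simp: Spec_def)
  moreover have "contraction S f Q\<^sub>3 \<subseteq> contraction S f J"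
    using J by (intro contraction_mono) (auto simp: Q\<^sub>3_def)
  ultimately have "\<one>\<^bsub>S\<^esub> \<notin> contraction S f Q\<^sub>3" "\<one>\<^bsub>S\<^esub> \<notin> contraction S f Q\<^sub>1"
    using strict by blast+
  then have "contraction S f Q\<^sub>3 \<noteq> carrier S" "contraction S f Q\<^sub>1 \<noteq> carrier S"
    using S.one_closed by metis+
  then have "contraction S f Q\<^sub>1 \<in> Spec S" "contraction S f Q\<^sub>3 \<in> Spec S"
    using prime_ideal_contraction Q1(1) Q3 by (auto simp: Spec_def)
  moreover have "Q\<^sub>1 \<subset> Q\<^sub>3" using Q1(3) strict by auto
  ultimately obtain Q\<^sub>2 where Q2: "prime_ideal R Q\<^sub>2" "Q\<^sub>1 \<subset> Q\<^sub>2" "Q\<^sub>2 \<subset> Q\<^sub>3" "contraction S f Q\<^sub>2 = P"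
    using sgb[unfolded SGB_def lies_over_def, rule_format, of "contraction S f Q\<^sub>1" P
        "contraction S f Q\<^sub>3" Q\<^sub>1 Q\<^sub>3] strict Q1(1) Q3 PS
    by (auto simp: Spec_def)
  show False
  proof (rule no_fit[OF Q2(1,4)])
    show "\<Union>L \<subseteq> Q\<^sub>2" using Q1(2) Q2(2) by (rule order.trans[OF _ psubset_imp_subset])
    show "Q\<^sub>2 \<subseteq> \<Inter>U" using Q2(3) unfolding Q\<^sub>3_def by (rule psubset_imp_subset)
  qed
qed

lemma cut_imp_SGB:
  assumes cut: "\<And>\<D> \<C> L U P. subset.chain (Spec S) \<D> \<Longrightarrow> maximal_D_chain S R f \<D> \<C> \<Longrightarrow>
    is_cut \<C> (L, U) \<Longrightarrow> L \<noteq> {} \<Longrightarrow> U \<noteq> {} \<Longrightarrow> P \<in> \<D> \<Longrightarrow>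
    (\<exists>Q\<in>L. P \<subseteq> contraction S f Q) \<or> (\<exists>Q\<in>U. contraction S f Q \<subseteq> P)"
  shows "SGB S R f"
  unfolding SGB_def lies_over_def
proof (intro ballI impI, elim conjE)
  fix P\<^sub>1 P\<^sub>2 P\<^sub>3 Q\<^sub>1 Q\<^sub>3
  assume P: "P\<^sub>1 \<in> Spec S" "P\<^sub>2 \<in> Spec S" "P\<^sub>3 \<in> Spec S" "P\<^sub>1 \<subset> P\<^sub>2" "P\<^sub>2 \<subset> P\<^sub>3"
    and Q: "Q\<^sub>1 \<in> Spec R" "Q\<^sub>3 \<in> Spec R" "Q\<^sub>1 \<subset> Q\<^sub>3"
      "contraction S f Q\<^sub>1 = P\<^sub>1" "contraction S f Q\<^sub>3 = P\<^sub>3"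
  have D: "subset.chain (Spec S) {P\<^sub>1, P\<^sub>2, P\<^sub>3}" using P by (auto simp: subset_chain_def)
  have "D_chain S R f {P\<^sub>1, P\<^sub>2, P\<^sub>3} {Q\<^sub>1, Q\<^sub>3}"
    using Q by (auto simp: D_chain_def subset_chain_def)
  then obtain \<C> where max: "maximal_D_chain S R f {P\<^sub>1, P\<^sub>2, P\<^sub>3} \<C>" and QC: "{Q\<^sub>1, Q\<^sub>3} \<subseteq> \<C>"
    by (rule D_chain_extends_to_maximal)
  then have C: "\<C> \<subseteq> Spec R" "\<And>X Y. X \<in> \<C> \<Longrightarrow> Y \<in> \<C> \<Longrightarrow> X \<subseteq> Y \<or> Y \<subseteq> X"
    "\<And>X. X \<in> \<C> \<Longrightarrow> contraction S f X \<in> {P\<^sub>1, P\<^sub>2, P\<^sub>3}"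
    by (auto simp: maximal_D_chain_def D_chain_def subset_chain_def)
  \<comment> \<open>Contraction is monotone, so for comparable members a strict inclusion of
    contractions decides which member is the smaller.\<close>
  have less: "X \<subset> Y" if "X \<in> \<C>" "Y \<in> \<C>" "contraction S f X \<subset> contraction S f Y" for X Y
    using C(2)[OF that(1,2)] contraction_mono[of Y X S f] that(3) by blast
  have "\<exists>Q\<^sub>2\<in>\<C>. contraction S f Q\<^sub>2 = P\<^sub>2"
  proof (rule ccontr)
    assume none: "\<not> ?thesis"
    let ?L = "{X \<in> \<C>. contraction S f X = P\<^sub>1}" and ?U = "{X \<in> \<C>. contraction S f X = P\<^sub>3}"
    have "is_cut \<C> (?L, ?U)"
      unfolding is_cut_def
    proof (intro conjI ballI)
      show "fst (?L, ?U) \<union> snd (?L, ?U) = \<C>" using C(3) none by auto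
      show "fst (?L, ?U) \<inter> snd (?L, ?U) = {}" using P by auto
      show "X < Y" if "X \<in> fst (?L, ?U)" "Y \<in> snd (?L, ?U)" for X Y
        using less[of X Y] that P by auto
    qed
    \<comment> \<open>The cut condition would give \<open>P\<^sub>2\<close> inside
      \<open>P\<^sub>1\<close> or \<open>P\<^sub>3\<close> inside \<open>P\<^sub>2\<close>; both
      parts of the cut are nonempty, as they contain \<open>Q\<^sub>1\<close> and
      \<open>Q\<^sub>3\<close>.\<close>
    from cut[OF D max this, of P\<^sub>2] show False using P Q QC by auto
  qed
  then obtain Q\<^sub>2 where Q2: "Q\<^sub>2 \<in> \<C>" "contraction S f Q\<^sub>2 = P\<^sub>2" by blast
  have "Q\<^sub>1 \<subset> Q\<^sub>2" "Q\<^sub>2 \<subset> Q\<^sub>3" using QC Q P Q2 by (intro less; simp)+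
  then show "\<exists>Q\<^sub>2\<in>Spec R. Q\<^sub>1 \<subset> Q\<^sub>2 \<and> Q\<^sub>2 \<subset> Q\<^sub>3 \<and> contraction S f Q\<^sub>2 = P\<^sub>2"
    using Q2 C(1) by blast
qed

theorem proposition2p7:
  fixes S :: "('a, 'm) ring_scheme" and R :: "('b, 'n) ring_scheme" and f :: "'a \<Rightarrow> 'b"
  assumes "ring S" and "\<one>\<^bsub>S\<^esub> \<noteq> \<zero>\<^bsub>S\<^esub>"
    and "ring R" and "\<one>\<^bsub>R\<^esub> \<noteq> \<zero>\<^bsub>R\<^esub>"
    and "f \<in> rng_hom S R"
    and "f ` carrier S \<subseteq> ring_center R"
  shows "SGB S R f \<longleftrightarrow>
    (\<forall>\<D>. subset.chain (Spec S) \<D> \<and> \<D> \<noteq> {} \<longrightarrow>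
      (\<forall>\<C>. maximal_D_chain S R f \<D> \<C> \<and> \<C> \<noteq> {} \<longrightarrow>
        (\<forall>\<A>. is_cut \<C> \<A> \<and> \<A> \<noteq> ({}, \<C>) \<and> \<A> \<noteq> (\<C>, {}) \<longrightarrow>
          (\<forall>P\<in>\<D>. (\<exists>Q\<^sub>1\<in>fst \<A>. P \<subseteq> contraction S f Q\<^sub>1) \<or>
                 (\<exists>Q\<^sub>2\<in>snd \<A>. contraction S f Q\<^sub>2 \<subseteq> P)))))"
    (is "_ \<longleftrightarrow> ?cuts")
proof
  interpret central_rng_hom S R f
    using assms by (intro central_rng_hom.intro central_rng_hom_axioms.intro)
  assume sgb: "SGB S R f"
  show ?cuts
  proof (intro allI impI ballI, elim conjE)
    fix \<D> \<C> \<A> P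
    assume D: "subset.chain (Spec S) \<D>" and max: "maximal_D_chain S R f \<D> \<C>"
      and cut: "is_cut \<C> \<A>" "\<A> \<noteq> ({}, \<C>)" "\<A> \<noteq> (\<C>, {})" and P: "P \<in> \<D>"
    \<comment> \<open>The two parts cover \<C>, so excluding the two trivial cuts amounts to both
      parts being nonempty.\<close>
    have "is_cut \<C> (fst \<A>, snd \<A>)" "fst \<A> \<noteq> {}" "snd \<A> \<noteq> {}"
      using cut by (cases \<A>; auto simp: is_cut_def)+
    then show "(\<exists>Q\<^sub>1\<in>fst \<A>. P \<subseteq> contraction S f Q\<^sub>1) \<or> (\<exists>Q\<^sub>2\<in>snd \<A>. contraction S f Q\<^sub>2 \<subseteq> P)"
      by (rule SGB_imp_cut[OF sgb D max _ _ _ P])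
  qed
next
  assume cuts: ?cuts
  show "SGB S R f"
  proof (rule cut_imp_SGB)
    fix \<D> \<C> L U P
    assume D: "subset.chain (Spec S) \<D>" and max: "maximal_D_chain S R f \<D> \<C>"
      and cut: "is_cut \<C> (L, U)" "L \<noteq> {}" "U \<noteq> {}" and P: "P \<in> \<D>"
    have "\<D> \<noteq> {}" "\<C> \<noteq> {}" "(L, U) \<noteq> ({}, \<C>)" "(L, U) \<noteq> (\<C>, {})"
      using P cut by (auto simp: is_cut_def)
    then show "(\<exists>Q\<in>L. P \<subseteq> contraction S f Q) \<or> (\<exists>Q\<in>U. contraction S f Q \<subseteq> P)"
      using cuts[rule_format, of \<D> \<C> "(L, U)" P] D max cut(1) P by simp
  qed
qed

end
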